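(* Consider the one-dimensional ten-moment system $\partial_t\mathbf u+\partial_x\mathbf f(\mathbf u)=\mathbf s_x(\mathbf u)$ with entropy $\mathcal U=-\rho s$ (all defined in the context), discretized on elements $I_i=[x_{i-1/2},x_{i+1/2}]$, $1\le i\le N$, of lengths $\Delta x_i$, by the semi-discrete discontinuous Galerkin scheme for the nodal values $\mathbf u^i_j(t)$, $0\le j\le k$, $$\frac{d\mathbf u^i_j}{dt}+\frac{4}{\Delta x_i}\sum_{l=0}^{k}D_{jl}\,\mathbf f^*(\mathbf u^i_j,\mathbf u^i_l)=\frac{2}{\Delta x_i}\frac{\tau_j}{\omega_j}\left(\mathbf f(\mathbf u^i_j)-\hat{\mathbf f}^i_j\right)+(\mathbf s_x)^i_j,$$ where $\mathbf f^*$ is an entropy conservative flux for $\mathcal U$, $\hat{\mathbf f}^i_0=\hat{\mathbf f}_{i-1/2}$, $\hat{\mathbf f}^i_k=\hat{\mathbf f}_{i+1/2}$, $\hat{\mathbf f}^i_j=0$ for $0<j<k$, and $\hat{\mathbf f}_{i+1/2}=\hat{\mathbf f}(\mathbf u^{i}_k,\mathbf u^{i+1}_0)$ is the numerical flux at the element interface. If the numerical flux $\hat{\mathbf f}$ at the element interface is entropy stable for $\mathcal U$, then the scheme is entropy stable.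
   Context: **The system.** The unknown is $\mathbf u=(\rho,\rho v^x,\rho v^y,E^{xx},E^{xy},E^{yy})^T\in\mathbb R^6$, where $E^{xx}=\rho (v^x)^2+p^{xx}$, $E^{xy}=\rho v^xv^y+p^{xy}$, $E^{yy}=\rho (v^y)^2+p^{yy}$. States are taken in the admissible set $\Omega$ of $\mathbf u$ with $\rho>0$ and symmetric pressure tensor $\mathbf p=\begin{pmatrix} p^{xx} & p^{xy} \\ p^{xy} & p^{yy} \end{pmatrix}$ positive definite. The flux is $$\mathbf f(\mathbf u)=\begin{pmatrix}\rho v^x\\ \rho (v^x)^2+p^{xx}\\ \rho v^xv^y+p^{xy}\\ \rho (v^x)^3+3v^xp^{xx}\\ \rho (v^x)^2v^y+2v^xp^{xy}+v^yp^{xx}\\ \rho v^x(v^y)^2+v^xp^{yy}+2v^yp^{xy}\end{pmatrix},$$ and the source is $\mathbf s_x(\mathbf u)=\left(0,\,-\tfrac12\rho\,\partial_xW,\,0,\,-\rho v^x\partial_xW,\,-\tfrac12\rho v^y\partial_xW,\,0\right)^T$ with $W=W(x,t)$ a given function; $(\mathbf s_x)^i_j$ is its value at the state $\mathbf u^i_j$ and the node $\frac{x_{i-1/2}+x_{i+1/2}}2+\frac{\xi_j}{2}\Delta x_i$. **Entropy.** $s=\ln\left(\det(\mathbf p)/\rho^4\right)$, $\mathcal U=-\rho s$, with entropy flux $\mathcal F=-\rho v^xs$. The entropy variable is $\mathbf v=\partial_{\mathbf u}\mathcal U$, and the entropy potential is $\psi=\mathbf v^T\mathbf f-\mathcal F$.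 Subscripts $L$, $R$ denote evaluation at a left state $\mathbf u_L$ and a right state $\mathbf u_R$; $\mathbf v^i_j$, $\psi^i_j$, $\mathcal U^i_j$ denote evaluation at $\mathbf u^i_j$. **Two-point fluxes.** A two-point flux is consistent if its value at $(\mathbf u,\mathbf u)$ is $\mathbf f(\mathbf u)$, and symmetric if exchanging its two arguments does not change its value. - A two-point symmetric, consistent numerical flux $\mathbf f^*$ is entropy conservative for $\mathcal U$ if $(\mathbf v_R-\mathbf v_L)^T\mathbf f^*(\mathbf u_R,\mathbf u_L)=\psi_R-\psi_L$. - A two-point symmetric, consistent numerical flux $\hat{\mathbf f}$ is entropy stable for $\mathcal U$ if $(\mathbf v_R-\mathbf v_L)^T\hat{\mathbf f}(\mathbf u_R,\mathbf u_L)\le\psi_R-\psi_L$. **Quadrature and matrices.** $-1=\xi_0<\xi_1<\dots<\xi_k=1$ are the $k+1$ Gauss–Lobatto points on $[-1,1]$ with weights $\omega_0,\dots,\omega_k$; $L_j(\xi)=\prod_{l=0,\,l\ne j}^{k}\frac{\xi-\xi_l}{\xi_j-\xi_l}$; $D_{jl}=L_l'(\xi_j)$; $\tau_0=-1$, $\tau_k=1$, $\tau_j=0$ for $0<j<k$. **Entropy stability of the scheme.** Within each element the discrete entropy satisfies $\frac{d}{dt}\sum_{j=0}^k\frac{\Delta x_i}{2}\omega_j\,\mathcal U^i_j=(\psi^i_k-(\mathbf v^i_k)^T\hat{\mathbf f}_{i+1/2})-(\psi^i_0-(\mathbf v^i_0)^T\hat{\mathbf f}_{i-1/2})$. The scheme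 is entropy stable in the sense that the resulting entropy production rate at the interface between $I_i$ and $I_{i+1}$, namely $(\mathbf v_0^{i+1}-\mathbf v_k^i)^T\hat{\mathbf f}(\mathbf u^{i}_k,\mathbf u^{i+1}_0)-(\psi_0^{i+1}-\psi_k^i)$, is nonpositive; hence, together with a compact or periodic boundary condition (so that the end points of the domain contribute no entropy), the total discrete entropy $\sum_{i}\sum_{j}\frac{\Delta x_i}{2}\omega_j\,\mathcal U^i_j$ does not increase in time, i.e. the scheme is globally entropy stable. *)

theory Defs
  imports "HOL-Analysis.Analysis" "HOL-Computational_Algebra.Polynomial"
begin

section \<open>The ten-moment system in one space dimension\<close>

text \<open>A state lists the conserved variables
  \<open>(\<rho>, \<rho> v\<^sup>x, \<rho> v\<^sup>y, E\<^sup>x\<^sup>x, E\<^sup>x\<^sup>y, E\<^sup>y\<^sup>y)\<close>; velocities and pressures are functions of it.\<close>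

type_synonym state = "real ^ 6"

definition rho :: "state \<Rightarrow> real" where
  "rho u = u $ 1"

definition vx :: "state \<Rightarrow> real" where
  "vx u = u $ 2 / rho u"

definition vy :: "state \<Rightarrow> real" where
  "vy u = u $ 3 / rho u"

definition pxx :: "state \<Rightarrow> real" where
  "pxx u = u $ 4 - rho u * (vx u)\<^sup>2"

definition pxy :: "state \<Rightarrow> real" where
  "pxy u = u $ 5 - rho u * vx u * vy u"

definition pyy :: "state \<Rightarrow> real" where
  "pyy u = u $ 6 - rho u * (vy u)\<^sup>2"

definition pressure :: "state \<Rightarrow> real ^ 2 ^ 2" where
  "pressure u = vector [vector [pxx u, pxy u], vector [pxy u, pyy u]]"

definition positive_definite :: "real ^ 'n ^ 'n \<Rightarrow> bool" where
  "positive_definite A \<longleftrightarrow> (\<forall>x. x \<noteq> 0 \<longrightarrow> x \<bullet> (A *v x) > 0)"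

definition admissible :: "state set" where
  "admissible = {u. rho u > 0 \<and> positive_definite (pressure u)}"

definition flux :: "state \<Rightarrow> state" where
  "flux u = vector
    [rho u * vx u,
     rho u * (vx u)\<^sup>2 + pxx u,
     rho u * vx u * vy u + pxy u,
     rho u * (vx u) ^ 3 + 3 * vx u * pxx u,
     rho u * (vx u)\<^sup>2 * vy u + 2 * vx u * pxy u + vy u * pxx u,
     rho u * vx u * (vy u)\<^sup>2 + vx u * pyy u + 2 * vy u * pxy u]"

text \<open>The second argument \<open>w\<close> is the value of \<open>\<partial>\<^sub>x W\<close> at the point in question.\<close>

definition source :: "state \<Rightarrow> real \<Rightarrow> state" where
  "source u w = vector
    [0,
     - (1/2) * rho u * w,
     0,
     - rho u * vx u * w,
     - (1/2) * rho u * vy u * w,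
     0]"

section \<open>Entropy\<close>

definition specific_entropy :: "state \<Rightarrow> real" where
  "specific_entropy u = ln (det (pressure u) / (rho u) ^ 4)"

definition entropy :: "state \<Rightarrow> real" where
  "entropy u = - rho u * specific_entropy u"

definition entropy_flux :: "state \<Rightarrow> real" where
  "entropy_flux u = - rho u * vx u * specific_entropy u"

text \<open>The vector of partial derivatives of the entropy in the conserved variables.\<close>

definition entropy_var :: "state \<Rightarrow> state" where
  "entropy_var u = (\<chi> m. frechet_derivative entropy (at u) (axis m 1))"

definition potential :: "state \<Rightarrow> real" where
  "potential u = entropy_var u \<bullet> flux u - entropy_flux u"

section \<open>Two-point fluxes\<close>

definition consistent_flux :: "(state \<Rightarrow> state \<Rightarrow> state) \<Rightarrow> bool" where
  "consistent_flux g \<longleftrightarrow> (\<forall>u\<in>admissible. g u u = flux u)"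

definition symmetric_flux :: "(state \<Rightarrow> state \<Rightarrow> state) \<Rightarrow> bool" where
  "symmetric_flux g \<longleftrightarrow> (\<forall>u\<in>admissible. \<forall>w\<in>admissible. g u w = g w u)"

definition entropy_conservative_flux :: "(state \<Rightarrow> state \<Rightarrow> state) \<Rightarrow> bool" where
  "entropy_conservative_flux g \<longleftrightarrow> symmetric_flux g \<and> consistent_flux g \<and>
    (\<forall>uL\<in>admissible. \<forall>uR\<in>admissible.
      (entropy_var uR - entropy_var uL) \<bullet> g uR uL = potential uR - potential uL)"

text \<open>The argument order of \<open>g\<close> is immaterial by symmetry. Note that symmetry, applied with the two
  states exchanged, turns the inequality into an equality.\<close>

definition entropy_stable_flux :: "(state \<Rightarrow> state \<Rightarrow> state) \<Rightarrow> bool" where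
  "entropy_stable_flux g \<longleftrightarrow> symmetric_flux g \<and> consistent_flux g \<and>
    (\<forall>uL\<in>admissible. \<forall>uR\<in>admissible.
      (entropy_var uR - entropy_var uL) \<bullet> g uR uL \<le> potential uR - potential uL)"

section \<open>Gauss--Lobatto quadrature and collocation matrices\<close>

text \<open>Rodrigues' formula.\<close>

definition legendre :: "nat \<Rightarrow> real poly" where
  "legendre k = smult (1 / (2 ^ k * fact k)) ((pderiv ^^ k) ([:-1, 0, 1:] ^ k))"

definition lagrange :: "nat \<Rightarrow> (nat \<Rightarrow> real) \<Rightarrow> nat \<Rightarrow> real \<Rightarrow> real" where
  "lagrange k \<xi> j x = (\<Prod>l\<in>{0..k} - {j}. (x - \<xi> l) / (\<xi> j - \<xi> l))"

text \<open>The end points together with the zeros of the derivative of the Legendre polynomial of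
  degree \<open>k\<close>, in increasing order; the weights are those of the interpolatory rule.
  The conditions on the end points exclude \<open>k = 0\<close>.\<close>

definition gauss_lobatto :: "nat \<Rightarrow> (nat \<Rightarrow> real) \<Rightarrow> (nat \<Rightarrow> real) \<Rightarrow> bool" where
  "gauss_lobatto k \<xi> \<omega> \<longleftrightarrow>
    strict_mono_on {0..k} \<xi> \<and> \<xi> 0 = -1 \<and> \<xi> k = 1 \<and>
    (\<forall>j. 0 < j \<and> j < k \<longrightarrow> poly (pderiv (legendre k)) (\<xi> j) = 0) \<and>
    (\<forall>j\<le>k. \<omega> j = integral {-1..1} (lagrange k \<xi> j))"

definition diff_matrix :: "nat \<Rightarrow> (nat \<Rightarrow> real) \<Rightarrow> nat \<Rightarrow> nat \<Rightarrow> real" where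
  "diff_matrix k \<xi> j l = deriv (lagrange k \<xi> l) (\<xi> j)"

definition tau :: "nat \<Rightarrow> nat \<Rightarrow> real" where
  "tau k j = (if j = 0 then -1 else if j = k then 1 else 0)"

section \<open>The semi-discrete scheme\<close>

text \<open>The number \<open>xh i\<close> is the interface point \<open>x\<^bsub>i+1/2\<^esub>\<close>, so element \<open>i\<close> is
  \<open>{xh (i - 1)..xh i}\<close> for \<open>1 \<le> i \<le> N\<close>. A discrete solution \<open>u i j t\<close> has elements
  \<open>1 \<le> i \<le> N\<close>; the indices \<open>i = 0\<close> and \<open>i = N + 1\<close> only carry the exterior traces
  \<open>u 0 k t\<close> and \<open>u (N + 1) 0 t\<close> that enter the two boundary fluxes.\<close>

type_synonym nodal = "nat \<Rightarrow> nat \<Rightarrow> real \<Rightarrow> state"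

definition cell_length :: "(nat \<Rightarrow> real) \<Rightarrow> nat \<Rightarrow> real" where
  "cell_length xh i = xh i - xh (i - 1)"

definition node :: "(nat \<Rightarrow> real) \<Rightarrow> (nat \<Rightarrow> real) \<Rightarrow> nat \<Rightarrow> nat \<Rightarrow> real" where
  "node xh \<xi> i j = (xh (i - 1) + xh i) / 2 + \<xi> j / 2 * cell_length xh i"

text \<open>The flux at \<open>x\<^bsub>i+1/2\<^esub>\<close>.\<close>

definition interface_flux ::
    "nat \<Rightarrow> (state \<Rightarrow> state \<Rightarrow> state) \<Rightarrow> nodal \<Rightarrow> nat \<Rightarrow> real \<Rightarrow> state" where
  "interface_flux k fhat u i t = fhat (u i k t) (u (i + 1) 0 t)"

definition nodal_flux ::
    "nat \<Rightarrow> (state \<Rightarrow> state \<Rightarrow> state) \<Rightarrow> nodal \<Rightarrow> nat \<Rightarrow> nat \<Rightarrow> real \<Rightarrow> state" where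
  "nodal_flux k fhat u i j t =
    (if j = 0 then interface_flux k fhat u (i - 1) t
     else if j = k then interface_flux k fhat u i t
     else 0)"

definition solution_admissible :: "nat \<Rightarrow> nat \<Rightarrow> real set \<Rightarrow> nodal \<Rightarrow> bool" where
  "solution_admissible N k J u \<longleftrightarrow>
    (\<forall>t\<in>J. (\<forall>i\<in>{1..N}. \<forall>j\<in>{0..k}. u i j t \<in> admissible) \<and>
      u 0 k t \<in> admissible \<and> u (N + 1) 0 t \<in> admissible)"

text \<open>The function \<open>Wx\<close> stands for \<open>\<partial>\<^sub>x W\<close>, and \<open>J\<close> is the time interval.\<close>

definition dg_scheme ::
    "nat \<Rightarrow> nat \<Rightarrow> (nat \<Rightarrow> real) \<Rightarrow> (nat \<Rightarrow> real) \<Rightarrow> (nat \<Rightarrow> real) \<Rightarrow>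
     (state \<Rightarrow> state \<Rightarrow> state) \<Rightarrow> (state \<Rightarrow> state \<Rightarrow> state) \<Rightarrow>
     (real \<Rightarrow> real \<Rightarrow> real) \<Rightarrow> real set \<Rightarrow> nodal \<Rightarrow> bool" where
  "dg_scheme N k \<xi> \<omega> xh fstar fhat Wx J u \<longleftrightarrow>
    (\<forall>i\<in>{1..N}. \<forall>j\<in>{0..k}. \<forall>t\<in>J. \<exists>du.
      (u i j has_vector_derivative du) (at t within J) \<and>
      du + (4 / cell_length xh i) *\<^sub>R
             (\<Sum>l=0..k. diff_matrix k \<xi> j l *\<^sub>R fstar (u i j t) (u i l t)) =
        (2 / cell_length xh i * (tau k j / \<omega> j)) *\<^sub>R
             (flux (u i j t) - nodal_flux k fhat u i j t) +
        source (u i j t) (Wx (node xh \<xi> i j) t))"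

section \<open>Discrete entropy\<close>

definition element_entropy ::
    "nat \<Rightarrow> (nat \<Rightarrow> real) \<Rightarrow> (nat \<Rightarrow> real) \<Rightarrow> nodal \<Rightarrow> nat \<Rightarrow> real \<Rightarrow> real" where
  "element_entropy k \<omega> xh u i t =
    (\<Sum>j=0..k. cell_length xh i / 2 * \<omega> j * entropy (u i j t))"

definition total_entropy ::
    "nat \<Rightarrow> nat \<Rightarrow> (nat \<Rightarrow> real) \<Rightarrow> (nat \<Rightarrow> real) \<Rightarrow> nodal \<Rightarrow> real \<Rightarrow> real" where
  "total_entropy N k \<omega> xh u t = (\<Sum>i=1..N. element_entropy k \<omega> xh u i t)"

definition interface_production ::
    "nat \<Rightarrow> (state \<Rightarrow> state \<Rightarrow> state) \<Rightarrow> nodal \<Rightarrow> nat \<Rightarrow> real \<Rightarrow> real" where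
  "interface_production k fhat u i t =
    (entropy_var (u (i + 1) 0 t) - entropy_var (u i k t)) \<bullet> fhat (u i k t) (u (i + 1) 0 t)
    - (potential (u (i + 1) 0 t) - potential (u i k t))"

definition periodic_bc :: "nat \<Rightarrow> nat \<Rightarrow> real set \<Rightarrow> nodal \<Rightarrow> bool" where
  "periodic_bc N k J u \<longleftrightarrow> (\<forall>t\<in>J. u 0 k t = u N k t \<and> u (N + 1) 0 t = u 1 0 t)"

text \<open>Since the density is positive, compact support can only be meant relative to background
  states: the solution equals a constant state at and beyond each end of the domain. The end
  points contribute no entropy when the two background states carry the same entropy flux, as is
  the case for a common background state or for a background at rest on both sides.\<close>

definition compact_bc :: "nat \<Rightarrow> nat \<Rightarrow> real set \<Rightarrow> nodal \<Rightarrow> bool" where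
  "compact_bc N k J u \<longleftrightarrow>
    (\<exists>uL\<in>admissible. \<exists>uR\<in>admissible. entropy_flux uL = entropy_flux uR \<and>
      (\<forall>t\<in>J. u 0 k t = uL \<and> u 1 0 t = uL \<and> u N k t = uR \<and> u (N + 1) 0 t = uR))"

end

theory Submission
  imports Defs
begin

text \<open>Inside an element, contract the equation at node \<open>j\<close> with \<open>\<omega> j\<close> times the entropy variable
  \<open>v j\<close> and sum over the nodes. The chain rule turns the time derivative into that of the discrete
  entropy. The source drops out: to first order, moving along it leaves the density and the
  pressure tensor fixed, and the entropy depends on nothing else (\<open>entropy_var_source\<close>).

  What remains is the volume term, a quadratic sum of \<open>v j \<bullet> fstar (u j) (u l)\<close> against the matrix
  \<open>Q j l = \<omega> j * D j l\<close>. Gauss--Lobatto quadrature integrates polynomials of degree \<open>2k - 1\<close>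
  exactly (\<open>gauss_lobatto_exact\<close>), because the node polynomial is a multiple of
  \<open>(x\<^sup>2 - 1) P\<^sub>k'(x)\<close>, which is orthogonal to all polynomials of degree at most \<open>k - 2\<close>. Hence
  integration by parts of \<open>L\<^sub>j L\<^sub>l'\<close> survives discretization: \<open>Q + Q\<^sup>T\<close> is the boundary matrix
  \<open>diag \<tau>\<close> (\<open>summation_by_parts\<close>). The antisymmetric part of \<open>Q\<close> therefore pairs the symmetric
  \<open>fstar\<close> with the differences \<open>v j - v l\<close>, where entropy conservation replaces the product by
  differences of the potential \<open>\<psi>\<close>; row and column sums of \<open>Q\<close> then reduce everything to the two
  end nodes (\<open>flux_differencing\<close>). This is the balance in each element.

  Summing over the elements, the two contributions at an interior interface combine to the entropy
  production there, which is nonpositive by entropy stability of \<open>fhat\<close>. The two remaining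
  contributions at the ends of the domain form one further production term if the boundary is
  periodic; for constant end states they are entropy fluxes by consistency, and cancel. So the
  derivative of the total entropy is nonpositive.\<close>

section \<open>The entropy and its gradient\<close>

lemma vector_6 [simp]:
  "(vector [a,b,c,d,e,f] :: 'a::zero^6) $ 1 = a"
  "(vector [a,b,c,d,e,f] :: 'a^6) $ 2 = b"
  "(vector [a,b,c,d,e,f] :: 'a^6) $ 3 = c"
  "(vector [a,b,c,d,e,f] :: 'a^6) $ 4 = d"
  "(vector [a,b,c,d,e,f] :: 'a^6) $ 5 = e"
  "(vector [a,b,c,d,e,f] :: 'a^6) $ 6 = f"
  by (simp_all add: vector_def)

lemma det_pressure: "det (pressure u) = pxx u * pyy u - (pxy u)\<^sup>2"
  by (simp add: pressure_def det_2 power2_eq_square)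

lemma admissible_rho_pos: "u \<in> admissible \<Longrightarrow> rho u > 0"
  by (simp add: admissible_def)

text \<open>Testing positive definiteness with \<open>(1, 0)\<close> gives \<open>pxx > 0\<close>; testing with the vector
  \<open>(- pxy, pxx)\<close>, orthogonal to the first row of the matrix, gives \<open>pxx\<close> times the determinant.\<close>

lemma admissible_det_pos:
  assumes "u \<in> admissible"
  shows "det (pressure u) > 0"
proof -
  have form: "0 < a * (pxx u * a + pxy u * b) + b * (pxy u * a + pyy u * b)"
    if "a \<noteq> 0 \<or> b \<noteq> 0" for a b
  proof -
    have "vector [a, b] \<noteq> (0 :: real^2)"
      using that by (metis vector_2 zero_index)
    then have "vector [a, b] \<bullet> (pressure u *v vector [a, b]) > 0"
      using assms by (auto simp: admissible_def positive_definite_def)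
    then show ?thesis
      by (simp add: inner_vec_def matrix_vector_mult_def sum_2 pressure_def)
  qed
  have 1: "pxx u > 0"
    using form[of 1 0] by simp
  have "pxx u * (pxx u * pyy u - (pxy u)\<^sup>2) > 0"
    using form[of "- pxy u" "pxx u"] 1 by (simp add: algebra_simps power2_eq_square)
  then show ?thesis
    using 1 by (simp add: det_pressure zero_less_mult_iff)
qed

lemma has_derivative_vec_nth: "((\<lambda>u. u $ i) has_derivative (\<lambda>h. h $ i)) (at u)"
  by (rule bounded_linear_imp_has_derivative[OF bounded_linear_vec_nth])

lemma has_derivative_rho: "(rho has_derivative (\<lambda>h. h $ 1)) (at u)"
  unfolding rho_def by (rule has_derivative_vec_nth)

lemma has_derivative_vx:
  assumes "rho u \<noteq> 0"
  shows "(vx has_derivative (\<lambda>h. (h $ 2 - vx u * h $ 1) / rho u)) (at u)"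
  unfolding vx_def
  by (rule has_derivative_vec_nth has_derivative_rho derivative_eq_intros refl assms)+
     (use assms in \<open>simp add: fun_eq_iff field_simps power2_eq_square\<close>)

lemma has_derivative_vy:
  assumes "rho u \<noteq> 0"
  shows "(vy has_derivative (\<lambda>h. (h $ 3 - vy u * h $ 1) / rho u)) (at u)"
  unfolding vy_def
  by (rule has_derivative_vec_nth has_derivative_rho derivative_eq_intros refl assms)+
     (use assms in \<open>simp add: fun_eq_iff field_simps power2_eq_square\<close>)

lemma has_derivative_pxx:
  assumes "rho u \<noteq> 0"
  shows "(pxx has_derivative (\<lambda>h. h $ 4 - 2 * vx u * h $ 2 + (vx u)\<^sup>2 * h $ 1)) (at u)"
  unfolding pxx_def
  by (rule has_derivative_vec_nth has_derivative_rho has_derivative_vx derivative_eq_intros refl assms)+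
     (use assms in \<open>simp add: fun_eq_iff field_simps power2_eq_square\<close>)

lemma has_derivative_pxy:
  assumes "rho u \<noteq> 0"
  shows "(pxy has_derivative
    (\<lambda>h. h $ 5 - vx u * h $ 3 - vy u * h $ 2 + vx u * vy u * h $ 1)) (at u)"
  unfolding pxy_def
  by (rule has_derivative_vec_nth has_derivative_rho has_derivative_vx has_derivative_vy derivative_eq_intros refl assms)+
     (use assms in \<open>simp add: fun_eq_iff field_simps power2_eq_square\<close>)

lemma has_derivative_pyy:
  assumes "rho u \<noteq> 0"
  shows "(pyy has_derivative (\<lambda>h. h $ 6 - 2 * vy u * h $ 3 + (vy u)\<^sup>2 * h $ 1)) (at u)"
  unfolding pyy_def
  by (rule has_derivative_vec_nth has_derivative_rho has_derivative_vy derivative_eq_intros refl assms)+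
     (use assms in \<open>simp add: fun_eq_iff field_simps power2_eq_square\<close>)

text \<open>The entropy is a function of the density and of the three pressures alone, so its derivative
  vanishes along every direction in which these four have derivative zero. The source is such a
  direction: it accelerates the gas and changes the energy tensor by exactly the corresponding
  change of the kinetic part.\<close>

lemma entropy_has_derivative:
  assumes "u \<in> admissible"
  obtains D where "(entropy has_derivative D) (at u)" "\<And>w. D (source u w) = 0"
proof -
  let ?r = "rho u" and ?d = "pxx u * pyy u - (pxy u)\<^sup>2"
  let ?dp = "\<lambda>h. (h $ 4 - 2 * vx u * h $ 2 + (vx u)\<^sup>2 * h $ 1) * pyy u
      + pxx u * (h $ 6 - 2 * vy u * h $ 3 + (vy u)\<^sup>2 * h $ 1)
      - 2 * pxy u * (h $ 5 - vx u * h $ 3 - vy u * h $ 2 + vx u * vy u * h $ 1)"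
  have r: "?r > 0" and d: "?d > 0"
    using admissible_rho_pos[OF assms] admissible_det_pos[OF assms] by (simp_all add: det_pressure)
  have arg: "?d / ?r ^ 4 > 0"
    using r d by simp
  have r0: "?r \<noteq> 0" "?r ^ 4 \<noteq> 0"
    using r by auto
  have dd: "((\<lambda>u. pxx u * pyy u - (pxy u)\<^sup>2) has_derivative ?dp) (at u)"
    by (rule has_derivative_pxx has_derivative_pxy has_derivative_pyy derivative_eq_intros
          refl r0)+ (simp add: fun_eq_iff algebra_simps)
  define E where "E = (\<lambda>h :: state. ?dp h / ?r ^ 4 - ?d * (4 * h $ 1) / ?r ^ 5)"
  have E: "((\<lambda>u. (pxx u * pyy u - (pxy u)\<^sup>2) / rho u ^ 4) has_derivative E) (at u)"
    unfolding E_def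
    by (rule dd has_derivative_rho derivative_eq_intros refl r0)+
       (use r0 in \<open>simp add: fun_eq_iff field_simps power_numeral_reduce\<close>)
  have "((\<lambda>u. - rho u * ln ((pxx u * pyy u - (pxy u)\<^sup>2) / rho u ^ 4)) has_derivative
      (\<lambda>h. - ?r * (E h / (?d / ?r ^ 4)) - h $ 1 * ln (?d / ?r ^ 4))) (at u)"
    by (rule E has_derivative_rho derivative_eq_intros refl arg)+ (simp add: fun_eq_iff)
  then have D: "(entropy has_derivative
      (\<lambda>h. - ?r * (E h / (?d / ?r ^ 4)) - h $ 1 * ln (?d / ?r ^ 4))) (at u)"
    by (simp add: entropy_def[abs_def] specific_entropy_def det_pressure)
  have "E (source u w) = 0" for w
    by (simp add: E_def source_def algebra_simps power2_eq_square)
  then show thesis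
    by (intro that[OF D]) (simp add: source_def)
qed

text \<open>Pairing with the vector of partial derivatives gives the full directional derivative only
  because the entropy is differentiable.\<close>

lemma entropy_var_inner:
  assumes "(entropy has_derivative D) (at u)"
  shows "entropy_var u \<bullet> h = D h"
proof -
  interpret D: bounded_linear D
    using assms by (rule has_derivative_bounded_linear)
  have "entropy_var u \<bullet> h = (\<Sum>m\<in>UNIV. D (h $ m *\<^sub>R axis m 1))"
    by (simp add: inner_vec_def entropy_var_def frechet_derivative_at[OF assms, symmetric] D.scaleR mult.commute)
  also have "\<dots> = D (\<Sum>m\<in>UNIV. h $ m *\<^sub>R axis m 1)"
    by (simp add: D.sum)
  also have "(\<Sum>m\<in>UNIV. h $ m *\<^sub>R axis m 1) = h"
    using basis_expansion[of h] by (simp add: scalar_mult_eq_scaleR)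
  finally show ?thesis .
qed

lemma entropy_var_source:
  assumes "u \<in> admissible"
  shows "entropy_var u \<bullet> source u w = 0"
  by (metis entropy_has_derivative[OF assms] entropy_var_inner)

lemma entropy_chain_rule:
  assumes "u t \<in> admissible" and "(u has_vector_derivative du) (at t within J)"
  shows "((\<lambda>t. entropy (u t)) has_real_derivative entropy_var (u t) \<bullet> du) (at t within J)"
proof -
  obtain D where D: "(entropy has_derivative D) (at (u t))"
    using entropy_has_derivative[OF assms(1)] by blast
  interpret D: bounded_linear D
    using D by (rule has_derivative_bounded_linear)
  have "((\<lambda>t. entropy (u t)) has_derivative (\<lambda>x. D (x *\<^sub>R du))) (at t within J)"
    using has_derivative_compose[OF assms(2)[unfolded has_vector_derivative_def] D] by simp
  then show ?thesis
    by (simp add: has_field_derivative_def D.scaleR entropy_var_inner[OF D] mult_commute_abs)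
qed

section \<open>Legendre polynomials\<close>

definition poly_integral :: "real poly \<Rightarrow> real" where
  "poly_integral p = integral {-1..1} (poly p)"

lemma poly_integrable: "poly p integrable_on {-1..1::real}"
  by (intro integrable_continuous_interval continuous_intros)

lemma poly_integral_add: "poly_integral (p + q) = poly_integral p + poly_integral q"
  unfolding poly_integral_def poly_add[abs_def] by (intro integral_add poly_integrable)

lemma poly_integral_smult: "poly_integral (smult c p) = c * poly_integral p"
  by (simp add: poly_integral_def poly_smult[abs_def])

lemma poly_integral_0 [simp]: "poly_integral 0 = 0"
  using poly_integral_smult[of 0 0] by simp

lemma poly_integral_sum: "poly_integral (\<Sum>i\<in>A. f i) = (\<Sum>i\<in>A. poly_integral (f i))"
  by (induction A rule: infinite_finite_induct) (auto simp: poly_integral_add)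

lemma poly_integral_pderiv: "poly_integral (pderiv p) = poly p 1 - poly p (-1)"
  unfolding poly_integral_def
  by (intro integral_unique fundamental_theorem_of_calculus)
     (auto simp flip: has_real_derivative_iff_has_vector_derivative
       intro: DERIV_subset[OF poly_DERIV])

lemma poly_integral_by_parts:
  "poly_integral (pderiv p * q)
    = poly (p * q) 1 - poly (p * q) (-1) - poly_integral (p * pderiv q)"
  using poly_integral_pderiv[of "p * q"]
  by (simp add: pderiv_mult poly_integral_add algebra_simps)


text \<open>Each differentiation lowers the multiplicity of the factor \<open>p\<close> by at most one. For
  \<open>p = x\<^sup>2 - 1\<close> this makes the boundary terms vanish when Rodrigues' formula is integrated by
  parts.\<close>

lemma power_dvd_higher_pderiv:
  fixes p :: "'a::{idom, semiring_char_0} poly"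
  assumes "m \<le> n"
  shows "p ^ (n - m) dvd (pderiv ^^ m) (p ^ n)"
  using assms
proof (induction m)
  case (Suc m)
  then obtain q where q: "(pderiv ^^ m) (p ^ n) = p ^ (n - m) * q"
    by (auto elim: dvdE)
  have n: "n - m = Suc (n - Suc m)"
    using Suc.prems by simp
  let ?s = "p ^ (n - Suc m)"
  have "(pderiv ^^ Suc m) (p ^ n) =
      p ^ Suc (n - Suc m) * pderiv q + q * (smult (of_nat (Suc (n - Suc m))) ?s * pderiv p)"
    by (simp only: funpow.simps comp_apply q n pderiv_mult pderiv_power_Suc)
  also have "\<dots> = ?s * (p * pderiv q + smult (of_nat (Suc (n - Suc m))) (q * pderiv p))"
    by (simp add: algebra_simps)
  finally have "(pderiv ^^ Suc m) (p ^ n) =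
      ?s * (p * pderiv q + smult (of_nat (Suc (n - Suc m))) (q * pderiv p))" .
  then show ?case
    by (metis dvd_triv_left)
qed simp

abbreviation endpoint_poly :: "real poly" where
  "endpoint_poly \<equiv> [:-1, 0, 1:]"

text \<open>Every integration by parts moves one derivative from the power of \<open>x\<^sup>2 - 1\<close> to \<open>q\<close>, without
  boundary terms, until \<open>q\<close> has been differentiated to zero.\<close>

lemma higher_pderiv_orthogonal:
  assumes "m \<le> n" and "degree q < m"
  shows "poly_integral ((pderiv ^^ m) (endpoint_poly ^ n) * q) = 0"
  using assms
proof (induction m arbitrary: q)
  case (Suc m)
  let ?A = "(pderiv ^^ m) (endpoint_poly ^ n)"
  have "endpoint_poly dvd endpoint_poly ^ (n - m)"
    using Suc.prems by (intro dvd_power) auto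
  then have "endpoint_poly dvd ?A"
    using power_dvd_higher_pderiv[of m n endpoint_poly] Suc.prems by (auto intro: dvd_trans)
  then have ends: "poly ?A 1 = 0" "poly ?A (-1) = 0"
    by (auto elim!: dvdE)
  have "poly_integral (?A * pderiv q) = 0"
  proof (cases "degree q = 0")
    case True
    then show ?thesis by (simp add: pderiv_eq_0_iff[THEN iffD2])
  next
    case False
    then show ?thesis
      using Suc by (intro Suc.IH) (auto simp: degree_pderiv)
  qed
  then show ?case
    by (simp add: poly_integral_by_parts ends)
qed simp

lemma legendre_orthogonal:
  assumes "degree q < k"
  shows "poly_integral (legendre k * q) = 0"
  by (simp add: legendre_def poly_integral_smult higher_pderiv_orthogonal assms)

lemma degree_legendre: "degree (legendre k) = k"
proof -
  have "endpoint_poly \<noteq> 0" by simp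
  then show ?thesis
    by (simp add: legendre_def degree_higher_pderiv degree_power_eq)
qed

text \<open>Integrating by parts, the factor \<open>x\<^sup>2 - 1\<close> kills the boundary terms, and \<open>P\<^sub>k\<close> is left
  against a polynomial of degree at most \<open>k - 1\<close>.\<close>

lemma pderiv_legendre_orthogonal:
  assumes "degree q + 2 \<le> k"
  shows "poly_integral (pderiv (legendre k) * (endpoint_poly * q)) = 0"
proof -
  have "degree (endpoint_poly * q) \<le> 2 + degree q"
    by (rule order_trans[OF degree_mult_le]) simp
  then have "degree (pderiv (endpoint_poly * q)) < k"
    using assms by (simp add: degree_pderiv)
  then have "poly_integral (legendre k * pderiv (endpoint_poly * q)) = 0"
    by (rule legendre_orthogonal)
  then show ?thesis
    by (simp add: poly_integral_by_parts)
qed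

section \<open>Exactness of Gauss--Lobatto quadrature\<close>

definition node_poly :: "nat \<Rightarrow> (nat \<Rightarrow> real) \<Rightarrow> real poly" where
  "node_poly k \<xi> = (\<Prod>l=0..k. [:- \<xi> l, 1:])"

definition lagrange_poly :: "nat \<Rightarrow> (nat \<Rightarrow> real) \<Rightarrow> nat \<Rightarrow> real poly" where
  "lagrange_poly k \<xi> j =
    smult (\<Prod>l\<in>{0..k} - {j}. 1 / (\<xi> j - \<xi> l)) (\<Prod>l\<in>{0..k} - {j}. [:- \<xi> l, 1:])"

lemma poly_lagrange_poly: "poly (lagrange_poly k \<xi> j) = lagrange k \<xi> j"
  by (simp add: fun_eq_iff lagrange_poly_def lagrange_def poly_prod prod_dividef prod.distrib)

lemma degree_lagrange_poly:
  assumes "j \<le> k"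
  shows "degree (lagrange_poly k \<xi> j) \<le> k"
proof -
  have "degree (\<Prod>l\<in>{0..k} - {j}. [:- \<xi> l, 1:]) = k"
    using assms by (subst degree_prod_eq_sum_degree) auto
  then show ?thesis
    by (metis lagrange_poly_def degree_smult_le)
qed

lemma diff_matrix_eq: "diff_matrix k \<xi> j l = poly (pderiv (lagrange_poly k \<xi> l)) (\<xi> j)"
  by (simp add: diff_matrix_def DERIV_imp_deriv poly_DERIV flip: poly_lagrange_poly)

lemma lagrange_at_node:
  assumes "inj_on \<xi> {0..k}" "j \<le> k" "l \<le> k"
  shows "lagrange k \<xi> j (\<xi> l) = (if l = j then 1 else 0)"
proof (cases "l = j")
  case True
  have "\<xi> j \<noteq> \<xi> m" if "m \<in> {0..k} - {j}" for m
    using assms that by (auto dest: inj_onD)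
  then show ?thesis
    by (simp add: True lagrange_def)
next
  case False
  then show ?thesis
    using assms by (auto simp: lagrange_def intro!: prod_zero)
qed

text \<open>Both sides have degree at most \<open>k\<close> and agree at \<open>k + 1\<close> points.\<close>

lemma lagrange_interpolation:
  assumes "inj_on \<xi> {0..k}" and "degree p \<le> k"
  shows "p = (\<Sum>j=0..k. smult (poly p (\<xi> j)) (lagrange_poly k \<xi> j))"
proof (rule poly_eqI_degree)
  show "poly p x = poly (\<Sum>j=0..k. smult (poly p (\<xi> j)) (lagrange_poly k \<xi> j)) x"
    if "x \<in> \<xi> ` {0..k}" for x
  proof -
    obtain l where l: "l \<le> k" "x = \<xi> l"
      using \<open>x \<in> \<xi> ` {0..k}\<close> by auto
    have "poly (\<Sum>j=0..k. smult (poly p (\<xi> j)) (lagrange_poly k \<xi> j)) x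
        = (\<Sum>j=0..k. if l = j then poly p (\<xi> j) else 0)"
      unfolding poly_sum poly_smult poly_lagrange_poly l(2)
      by (rule sum.cong) (auto simp: lagrange_at_node assms(1) l(1))
    then show ?thesis
      using l by simp
  qed
  have card: "card (\<xi> ` {0..k}) = Suc k"
    by (simp add: card_image assms(1))
  show "degree p < card (\<xi> ` {0..k})"
    using assms(2) by (simp add: card)
  have "degree (\<Sum>j=0..k. smult (poly p (\<xi> j)) (lagrange_poly k \<xi> j)) \<le> k"
    by (rule degree_sum_le) (auto intro: order_trans[OF degree_smult_le] degree_lagrange_poly)
  then show "degree (\<Sum>j=0..k. smult (poly p (\<xi> j)) (lagrange_poly k \<xi> j)) < card (\<xi> ` {0..k})"
    by (simp add: card)
qed

lemma gauss_lobatto_inj: "gauss_lobatto k \<xi> \<omega> \<Longrightarrow> inj_on \<xi> {0..k}"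
  by (simp add: gauss_lobatto_def strict_mono_on_imp_inj_on)

lemma gauss_lobatto_pos: "gauss_lobatto k \<xi> \<omega> \<Longrightarrow> k > 0"
  by (rule gr0I) (auto simp: gauss_lobatto_def)

text \<open>The interior nodes are \<open>k - 1\<close> distinct zeros of \<open>P\<^sub>k'\<close>, which has degree \<open>k - 1\<close>; they are
  therefore all of its zeros.\<close>

lemma node_poly_legendre:
  assumes "gauss_lobatto k \<xi> \<omega>"
  obtains c where "node_poly k \<xi> = smult c (endpoint_poly * pderiv (legendre k))"
proof -
  let ?I = "\<Prod>l\<in>{0<..<k}. [:- \<xi> l, 1:]" and ?P = "pderiv (legendre k)"
  let ?c = "lead_coeff ?P"
  have k: "k > 0"
    using assms by (rule gauss_lobatto_pos)
  have inj: "inj_on \<xi> {0<..<k}"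
    by (rule inj_on_subset[OF gauss_lobatto_inj[OF assms]]) auto
  have degP: "degree ?P = k - 1"
    by (simp add: degree_pderiv degree_legendre)
  have "?P \<noteq> 0"
    using k degree_legendre[of k] by (auto simp: pderiv_eq_0_iff)
  then have c: "?c \<noteq> 0"
    by simp
  have degI: "degree ?I = k - 1"
    by (subst degree_prod_eq_sum_degree) auto
  have "?I = smult (1 / ?c) ?P"
  proof (rule poly_eqI_degree_lead_coeff)
    show "coeff ?I (k - 1) = coeff (smult (1 / ?c) ?P) (k - 1)"
      using c degP degI lead_coeff_prod[of "\<lambda>l. [:- \<xi> l, 1:]" "{0<..<k}"] by simp
    show "poly ?I x = poly (smult (1 / ?c) ?P) x" if "x \<in> \<xi> ` {0<..<k}" for x
    proof -
      obtain l where l: "l \<in> {0<..<k}" "x = \<xi> l"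
        using \<open>x \<in> \<xi> ` {0<..<k}\<close> by blast
      then have "poly ?I x = 0"
        by (auto simp: poly_prod intro!: prod_zero bexI[of _ l])
      then show ?thesis
        using l assms by (simp add: gauss_lobatto_def)
    qed
  qed (use degP degI inj in \<open>auto simp: card_image\<close>)
  moreover have "{0..k} = insert 0 (insert k {0<..<k})"
    using k by auto
  then have "node_poly k \<xi> = endpoint_poly * ?I"
    using k assms by (simp add: node_poly_def gauss_lobatto_def flip: mult.assoc)
  ultimately have "node_poly k \<xi> = smult (1 / ?c) (endpoint_poly * ?P)"
    by (metis mult_smult_right)
  then show thesis
    by (rule that)
qed

text \<open>Divide \<open>p\<close> by the node polynomial. The remainder has degree at most \<open>k\<close> and is integrated
  exactly, the rule being interpolatory. The multiple of the node polynomial vanishes at all nodes,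
  and its integral is zero too because the quotient is zero or has degree at most \<open>k - 2\<close>.\<close>

lemma gauss_lobatto_exact:
  assumes gl: "gauss_lobatto k \<xi> \<omega>" and deg: "degree p \<le> 2 * k - 1"
  shows "poly_integral p = (\<Sum>j=0..k. \<omega> j * poly p (\<xi> j))"
proof -
  let ?n = "node_poly k \<xi>" let ?q = "p div ?n" and ?r = "p mod ?n"
  have degn: "degree ?n = Suc k"
    by (simp add: node_poly_def degree_prod_eq_sum_degree)
  then have n0: "?n \<noteq> 0"
    by auto
  have "poly_integral (?q * ?n) = 0"
  proof (cases "?q = 0")
    case False
    then have "degree ?n \<le> degree p"
      by (metis div_poly_less not_le)
    then have "degree (p - ?r) \<le> degree p"
      using degree_mod_less[OF n0, of p] by (intro degree_diff_le) auto
    then have "degree (?q * ?n) \<le> degree p"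
      by (simp add: minus_mod_eq_div_mult)
    then have "degree ?q + Suc k \<le> degree p"
      using False n0 degn by (simp add: degree_mult_eq)
    then have "degree ?q + 2 \<le> k"
      using deg by linarith
    then have orth: "poly_integral (pderiv (legendre k) * (endpoint_poly * ?q)) = 0"
      by (rule pderiv_legendre_orthogonal)
    obtain c where c: "?n = smult c (endpoint_poly * pderiv (legendre k))"
      using node_poly_legendre[OF gl] .
    have "?q * ?n = ?q * smult c (endpoint_poly * pderiv (legendre k))"
      by (rule arg_cong[OF c])
    also have "\<dots> = smult c (pderiv (legendre k) * (endpoint_poly * ?q))"
      by (simp only: mult_smult_right mult_ac)
    finally show ?thesis
      by (simp only: poly_integral_smult orth mult_zero_right)
  qed simp
  moreover have "poly_integral ?r = (\<Sum>j=0..k. \<omega> j * poly ?r (\<xi> j))"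
  proof -
    have "degree ?r \<le> k"
      using degree_mod_less[OF n0, of p] degn by auto
    then have "poly_integral ?r =
        poly_integral (\<Sum>j=0..k. smult (poly ?r (\<xi> j)) (lagrange_poly k \<xi> j))"
      using lagrange_interpolation[OF gauss_lobatto_inj[OF gl]] by metis
    also have "\<dots> = (\<Sum>j=0..k. poly ?r (\<xi> j) * poly_integral (lagrange_poly k \<xi> j))"
      by (simp add: poly_integral_sum poly_integral_smult)
    also have "\<dots> = (\<Sum>j=0..k. \<omega> j * poly ?r (\<xi> j))"
      using gl by (intro sum.cong)
        (auto simp: gauss_lobatto_def poly_integral_def poly_lagrange_poly)
    finally show ?thesis .
  qed
  moreover have "poly ?r (\<xi> j) = poly p (\<xi> j)" if "j \<in> {0..k}" for j
  proof -
    have "poly ?n (\<xi> j) = 0"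
      using that by (auto simp: node_poly_def poly_prod intro!: prod_zero)
    then show ?thesis
      by (metis add_0 div_mult_mod_eq mult_zero_right poly_add poly_mult)
  qed
  moreover have "poly_integral p = poly_integral (?q * ?n) + poly_integral ?r"
    by (metis div_mult_mod_eq poly_integral_add)
  ultimately show ?thesis
    by simp
qed

section \<open>Summation by parts\<close>

text \<open>The product \<open>L\<^sub>j L\<^sub>l'\<close> has degree at most \<open>2k - 1\<close>, so its integral equals its quadrature sum,
  in which only the node \<open>j\<close> contributes. The identity is then \<open>\<integral> (L\<^sub>j L\<^sub>l)' = [L\<^sub>j L\<^sub>l]\<close> over
  \<open>[-1, 1]\<close>.\<close>

lemma summation_by_parts:
  assumes gl: "gauss_lobatto k \<xi> \<omega>" and "j \<le> k" "l \<le> k"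
  shows "\<omega> j * diff_matrix k \<xi> j l + \<omega> l * diff_matrix k \<xi> l j = (if j = l then tau k j else 0)"
proof -
  let ?L = "lagrange_poly k \<xi>"
  have k: "k > 0"
    using gl by (rule gauss_lobatto_pos)
  have node: "poly (?L a) (\<xi> b) = (if b = a then 1 else 0)" if "a \<le> k" "b \<le> k" for a b
    by (simp add: poly_lagrange_poly lagrange_at_node gauss_lobatto_inj[OF gl] that)
  have ends: "poly (?L a) (-1) = (if a = 0 then 1 else 0)"
      "poly (?L a) 1 = (if a = k then 1 else 0)" if "a \<le> k" for a
    using node[OF that, of 0] node[OF that, of k] gl by (auto simp: gauss_lobatto_def)
  have product: "poly_integral (?L a * pderiv (?L b)) = \<omega> a * diff_matrix k \<xi> a b"
    if "a \<le> k" "b \<le> k" for a b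
  proof -
    have "degree (?L a * pderiv (?L b)) \<le> k + (k - 1)"
      using degree_lagrange_poly[OF \<open>a \<le> k\<close>, of \<xi>] degree_lagrange_poly[OF \<open>b \<le> k\<close>, of \<xi>]
      by (intro order_trans[OF degree_mult_le] add_mono) (auto simp: degree_pderiv)
    also have "\<dots> = 2 * k - 1"
      using k by simp
    finally have "poly_integral (?L a * pderiv (?L b))
        = (\<Sum>i=0..k. \<omega> i * poly (?L a * pderiv (?L b)) (\<xi> i))"
      by (rule gauss_lobatto_exact[OF gl])
    also have "\<dots> = (\<Sum>i=0..k. if a = i then \<omega> i * diff_matrix k \<xi> i b else 0)"
      using that by (intro sum.cong) (auto simp: node diff_matrix_eq)
    finally show ?thesis
      using that by simp
  qed
  have "\<omega> j * diff_matrix k \<xi> j l + \<omega> l * diff_matrix k \<xi> l j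
      = poly_integral (pderiv (?L j * ?L l))"
    using assms by (simp add: pderiv_mult poly_integral_add product)
  also have "\<dots> = (if j = l then tau k j else 0)"
    using assms k by (auto simp: poly_integral_pderiv ends tau_def)
  finally show ?thesis .
qed

text \<open>The scheme divides by the weights, so the end weights must not vanish. The diagonal case of
  summation by parts settles this: it reads \<open>2 * \<omega> j * D j j = \<tau> j\<close>, and \<open>\<tau>\<close> is \<open>-1\<close> or \<open>1\<close> at the
  ends.\<close>

lemma tau_weight:
  assumes "gauss_lobatto k \<xi> \<omega>" and "j \<le> k"
  shows "\<omega> j * (tau k j / \<omega> j) = tau k j"
  using summation_by_parts[OF assms assms(2)] by auto

text \<open>The Lagrange polynomials add up to the constant one, whose derivative is zero.\<close>

lemma diff_matrix_row_sum:
  assumes "gauss_lobatto k \<xi> \<omega>"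
  shows "(\<Sum>l=0..k. diff_matrix k \<xi> j l) = 0"
proof -
  have "(1 :: real poly) = (\<Sum>l=0..k. lagrange_poly k \<xi> l)"
    using lagrange_interpolation[OF gauss_lobatto_inj[OF assms], of 1] by simp
  then have "pderiv (\<Sum>l=0..k. lagrange_poly k \<xi> l) = 0"
    by (metis pderiv_1)
  then show ?thesis
    using higher_pderiv_sum[of 1 "lagrange_poly k \<xi>" "{0..k}"]
    by (simp add: diff_matrix_eq flip: poly_sum)
qed

text \<open>Here \<open>G\<close> stands for the two-point flux, \<open>F\<close> for its diagonal, \<open>v\<close> for the entropy variables and
  \<open>\<psi>\<close> for the potential. Write \<open>X\<close> for the sum of \<open>Q j l * (v j \<bullet> G j l)\<close>. Exchanging the summation
  indices and replacing \<open>Q l j\<close> by \<open>diag \<tau> - Q j l\<close> gives \<open>X\<close> = (boundary terms) + (potential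
  differences) - \<open>X\<close>, which determines \<open>2 X\<close>. The rows of \<open>Q\<close> sum to zero and hence, again by
  \<open>Q + Q\<^sup>T = diag \<tau>\<close>, its columns sum to \<open>\<tau>\<close>; so the potential differences, too, leave only end
  terms.\<close>

lemma flux_differencing:
  fixes v F :: "nat \<Rightarrow> 'a::real_inner" and G :: "nat \<Rightarrow> nat \<Rightarrow> 'a"
  assumes gl: "gauss_lobatto k \<xi> \<omega>"
    and sym: "\<And>j l. j \<le> k \<Longrightarrow> l \<le> k \<Longrightarrow> G j l = G l j"
    and cons: "\<And>j. j \<le> k \<Longrightarrow> G j j = F j"
    and shuffle: "\<And>j l. j \<le> k \<Longrightarrow> l \<le> k \<Longrightarrow> (v j - v l) \<bullet> G j l = \<psi> j - \<psi> l"
  shows "2 * (\<Sum>j=0..k. \<omega> j * (\<Sum>l=0..k. diff_matrix k \<xi> j l * (v j \<bullet> G j l)))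
    = (\<Sum>j=0..k. tau k j * (v j \<bullet> F j - \<psi> j))"
proof -
  let ?A = "{0..k}"
  define Q where "Q j l = \<omega> j * diff_matrix k \<xi> j l" for j l
  have sbp: "Q l j = (if j = l then tau k j else 0) - Q j l" if "j \<in> ?A" "l \<in> ?A" for j l
    using summation_by_parts[OF gl, of j l] that by (simp add: Q_def)
  have row: "(\<Sum>l\<in>?A. Q j l) = 0" for j
    by (simp add: Q_def diff_matrix_row_sum[OF gl] flip: sum_distrib_left)
  have column: "(\<Sum>j\<in>?A. Q j l) = tau k l" if "l \<in> ?A" for l
  proof -
    have "(\<Sum>j\<in>?A. Q j l) = (\<Sum>j\<in>?A. (if l = j then tau k l else 0) - Q l j)"
      by (intro sum.cong refl) (simp only: sbp[OF that])
    then show ?thesis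
      using that by (simp add: sum_subtractf row)
  qed
  have "(\<Sum>j\<in>?A. \<Sum>l\<in>?A. Q j l * (v j \<bullet> G j l)) = (\<Sum>j\<in>?A. \<Sum>l\<in>?A. Q l j * (v l \<bullet> G l j))"
    by (rule sum.swap)
  also have "\<dots> = (\<Sum>j\<in>?A. \<Sum>l\<in>?A. (if j = l then tau k j * (v j \<bullet> F j) else 0)
      + (Q j l * \<psi> j - Q j l * \<psi> l) - Q j l * (v j \<bullet> G j l))"
  proof (intro sum.cong refl)
    fix j l assume jl: "j \<in> ?A" "l \<in> ?A"
    then have swap: "v l \<bullet> G l j = v j \<bullet> G j l - (\<psi> j - \<psi> l)"
      using shuffle[of j l] sym[of j l] by (simp add: inner_diff_left)
    have "Q l j * (v l \<bullet> G l j)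
        = ((if j = l then tau k j else 0) - Q j l) * (v j \<bullet> G j l - (\<psi> j - \<psi> l))"
      by (simp only: sbp[OF jl] swap)
    also have "\<dots> = (if j = l then tau k j * (v j \<bullet> F j) else 0)
        + (Q j l * \<psi> j - Q j l * \<psi> l) - Q j l * (v j \<bullet> G j l)"
    proof (cases "j = l")
      case True
      then show ?thesis
        using cons[of l] jl by (simp add: left_diff_distrib)
    next
      case False
      then show ?thesis
        by (simp add: algebra_simps)
    qed
    finally show "Q l j * (v l \<bullet> G l j) = (if j = l then tau k j * (v j \<bullet> F j) else 0)
        + (Q j l * \<psi> j - Q j l * \<psi> l) - Q j l * (v j \<bullet> G j l)" .
  qed
  also have "\<dots> = (\<Sum>j\<in>?A. tau k j * (v j \<bullet> F j))
      + ((\<Sum>j\<in>?A. (\<Sum>l\<in>?A. Q j l) * \<psi> j) - (\<Sum>l\<in>?A. (\<Sum>j\<in>?A. Q j l) * \<psi> l))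
      - (\<Sum>j\<in>?A. \<Sum>l\<in>?A. Q j l * (v j \<bullet> G j l))"
    using sum.swap[of "\<lambda>j l. Q j l * \<psi> l" ?A ?A]
    by (simp add: sum.distrib sum_subtractf sum_distrib_right)
  finally show ?thesis
    by (simp add: Q_def[symmetric] sum_distrib_left row column right_diff_distrib sum_subtractf
        flip: mult.assoc)
qed

section \<open>Entropy balance of the scheme\<close>

lemma element_entropy_balance:
  assumes gl: "gauss_lobatto k \<xi> \<omega>"
    and len: "xh (i - 1) < xh i"
    and ec: "entropy_conservative_flux fstar"
    and adm: "solution_admissible N k J u"
    and dg: "dg_scheme N k \<xi> \<omega> xh fstar fhat Wx J u"
    and i: "i \<in> {1..N}" and t: "t \<in> J"
  shows "(element_entropy k \<omega> xh u i has_real_derivative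
               (potential (u i k t) - entropy_var (u i k t) \<bullet> interface_flux k fhat u i t)
               - (potential (u i 0 t) - entropy_var (u i 0 t) \<bullet> interface_flux k fhat u (i - 1) t))
            (at t within J)"
proof -
  let ?A = "{0..k}" and ?h = "cell_length xh i"
  let ?U = "\<lambda>j. u i j t"
  let ?v = "\<lambda>j. entropy_var (?U j)" and ?psi = "\<lambda>j. potential (?U j)"
    and ?F = "\<lambda>j. nodal_flux k fhat u i j t"
    and ?S = "\<lambda>j. \<Sum>l\<in>?A. diff_matrix k \<xi> j l *\<^sub>R fstar (?U j) (?U l)"
  have k: "k > 0"
    using gl by (rule gauss_lobatto_pos)
  have h: "?h > 0"
    using len by (simp add: cell_length_def)
  have U: "?U j \<in> admissible" if "j \<in> ?A" for j
    using adm i t that by (auto simp: solution_admissible_def)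
  let ?rhs = "\<lambda>j. (2 / ?h * (tau k j / \<omega> j)) *\<^sub>R (flux (?U j) - ?F j)
      + source (?U j) (Wx (node xh \<xi> i j) t)"
  have "\<forall>j\<in>?A. \<exists>d. (u i j has_vector_derivative d) (at t within J) \<and>
      d + (4 / ?h) *\<^sub>R ?S j = ?rhs j"
    using dg i t unfolding dg_scheme_def by blast
  then obtain du where "\<forall>j\<in>?A. (u i j has_vector_derivative du j) (at t within J) \<and>
      du j + (4 / ?h) *\<^sub>R ?S j = ?rhs j"
    unfolding bchoice_iff by blast
  then have du: "(u i j has_vector_derivative du j) (at t within J)"
      "du j = ?rhs j - (4 / ?h) *\<^sub>R ?S j" if "j \<in> ?A" for j
    using that by (auto simp: eq_diff_eq)
  have der: "((\<lambda>t. \<Sum>j\<in>?A. ?h / 2 * \<omega> j * entropy (u i j t)) has_real_derivative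
      (\<Sum>j\<in>?A. ?h / 2 * \<omega> j * (?v j \<bullet> du j))) (at t within J)"
    by (intro DERIV_sum DERIV_cmult entropy_chain_rule U du(1))
  have nodal: "?h / 2 * \<omega> j * (?v j \<bullet> du j) =
      tau k j * (?v j \<bullet> flux (?U j) - ?v j \<bullet> ?F j) - 2 * (\<omega> j * (?v j \<bullet> ?S j))" if "j \<in> ?A" for j
  proof -
    have "?v j \<bullet> du j = 2 / ?h * (tau k j / \<omega> j) * (?v j \<bullet> flux (?U j) - ?v j \<bullet> ?F j)
        - 4 / ?h * (?v j \<bullet> ?S j)"
      unfolding du(2)[OF that] inner_diff_right inner_add_right inner_scaleR_right
      using entropy_var_source[OF U[OF that]] by simp
    then have "?h / 2 * \<omega> j * (?v j \<bullet> du j) =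
        \<omega> j * (tau k j / \<omega> j) * (?v j \<bullet> flux (?U j) - ?v j \<bullet> ?F j) - 2 * (\<omega> j * (?v j \<bullet> ?S j))"
      using h by (simp add: right_diff_distrib)
    then show ?thesis
      using tau_weight[OF gl, of j] that by simp
  qed
  have volume: "2 * (\<Sum>j\<in>?A. \<omega> j * (?v j \<bullet> ?S j))
      = (\<Sum>j\<in>?A. tau k j * (?v j \<bullet> flux (?U j) - ?psi j))"
    unfolding inner_sum_right inner_scaleR_right
    using ec U by (intro flux_differencing[OF gl])
      (auto simp: entropy_conservative_flux_def symmetric_flux_def consistent_flux_def)
  have "(\<Sum>j\<in>?A. ?h / 2 * \<omega> j * (?v j \<bullet> du j))
      = (\<Sum>j\<in>?A. tau k j * (?v j \<bullet> flux (?U j) - ?v j \<bullet> ?F j))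
        - 2 * (\<Sum>j\<in>?A. \<omega> j * (?v j \<bullet> ?S j))"
    by (simp only: nodal sum_subtractf sum_distrib_left cong: sum.cong)
  \<comment> \<open>The physical fluxes at the end nodes cancel; only potentials and numerical fluxes remain.\<close>
  also have "\<dots> = (\<Sum>j\<in>?A. tau k j * (?psi j - ?v j \<bullet> ?F j))"
    unfolding volume by (simp add: right_diff_distrib flip: sum_subtractf)
  also have "\<dots> = (\<Sum>j\<in>{0, k}. tau k j * (?psi j - ?v j \<bullet> ?F j))"
    by (rule sum.mono_neutral_right) (auto simp: tau_def)
  also have "\<dots> = (?psi k - ?v k \<bullet> interface_flux k fhat u i t)
      - (?psi 0 - ?v 0 \<bullet> interface_flux k fhat u (i - 1) t)"
    using k by (simp add: tau_def nodal_flux_def)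
  finally have total: "(\<Sum>j\<in>?A. ?h / 2 * \<omega> j * (?v j \<bullet> du j))
      = (?psi k - ?v k \<bullet> interface_flux k fhat u i t)
        - (?psi 0 - ?v 0 \<bullet> interface_flux k fhat u (i - 1) t)" .
  have "element_entropy k \<omega> xh u i = (\<lambda>t. \<Sum>j\<in>?A. ?h / 2 * \<omega> j * entropy (u i j t))"
    by (simp add: fun_eq_iff element_entropy_def)
  then show ?thesis
    using der unfolding total by (simp only:)
qed

text \<open>Symmetry of the flux reconciles the argument order of the scheme (left state first) with that
  of the stability inequality (right state first).\<close>

lemma interface_production_nonpos:
  assumes "entropy_stable_flux fhat"
    and "u i k t \<in> admissible" and "u (i + 1) 0 t \<in> admissible"
  shows "interface_production k fhat u i t \<le> 0"
  using assms
  unfolding interface_production_def entropy_stable_flux_def symmetric_flux_def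
  by (metis diff_le_0_iff_le)

text \<open>What leaves element \<open>i\<close> at its right end meets what enters element \<open>i + 1\<close> at its left end, with
  the same numerical flux; the difference is the production at that interface.\<close>

lemma sum_element_balance:
  fixes u :: nodal and k :: nat and t :: real and fhat :: "state \<Rightarrow> state \<Rightarrow> state"
  assumes "N \<ge> 1"
  defines "right \<equiv> \<lambda>i. potential (u i k t) - entropy_var (u i k t) \<bullet> interface_flux k fhat u i t"
    and "left \<equiv> \<lambda>i. potential (u i 0 t) - entropy_var (u i 0 t) \<bullet> interface_flux k fhat u (i - 1) t"
  shows "(\<Sum>i=1..N. right i - left i)
    = (\<Sum>i=1..<N. interface_production k fhat u i t) + (right N - left 1)"
  using assms(1)
proof (induction N rule: nat_induct_at_least)
  case base
  then show ?case by simp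
next
  case (Suc n)
  have "right n - left (Suc n) = interface_production k fhat u n t"
    by (simp add: right_def left_def interface_production_def interface_flux_def inner_diff_left)
  then show ?case
    using Suc by simp
qed


lemma nonpos_derivative_antimono_on:
  fixes f f' :: "real \<Rightarrow> real"
  assumes "is_interval J"
    and der: "\<And>t. t \<in> J \<Longrightarrow> (f has_real_derivative f' t) (at t within J)"
    and nonpos: "\<And>t. t \<in> J \<Longrightarrow> f' t \<le> 0"
  shows "antimono_on J f"
proof (rule monotone_onI)
  fix a b assume ab: "a \<in> J" "b \<in> J" "a \<le> b"
  then have sub: "{a..b} \<subseteq> J"
    using assms(1) by (meson atLeastAtMost_iff mem_is_interval_1_I subsetI)
  then have "(f has_derivative (*) (f' t)) (at t within {a..b})" if "t \<in> {a..b}" for t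
    using der[of t] that has_field_derivative_def has_field_derivative_subset by blast
  then obtain t where t: "t \<in> {a..b}" "f b - f a = f' t * (b - a)"
    using mvt_very_simple[OF ab(3), of f "\<lambda>t. (*) (f' t)"] by auto
  then show "f b \<le> f a"
    using nonpos[of t] t sub ab(3) mult_nonpos_nonneg[of "f' t" "b - a"] by auto
qed

lemma consistent_boundary_flux:
  assumes "consistent_flux fhat" and "u \<in> admissible"
  shows "potential u - entropy_var u \<bullet> fhat u u = - entropy_flux u"
  using assms by (simp add: consistent_flux_def potential_def)

theorem theorem3p2:
  fixes N k :: nat
    and \<xi> \<omega> xh :: "nat \<Rightarrow> real"
    and fstar fhat :: "state \<Rightarrow> state \<Rightarrow> state"
    and W Wx :: "real \<Rightarrow> real \<Rightarrow> real"
    and J :: "real set"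
    and u :: nodal
  assumes "N \<ge> 1"
    and "gauss_lobatto k \<xi> \<omega>"
    and "\<And>i. i \<in> {1..N} \<Longrightarrow> xh (i - 1) < xh i"
    and "is_interval J"
    and "\<And>x t. x \<in> {xh 0..xh N} \<Longrightarrow> t \<in> J \<Longrightarrow>
           ((\<lambda>y. W y t) has_real_derivative Wx x t) (at x within {xh 0..xh N})"
    and "entropy_conservative_flux fstar"
    and "solution_admissible N k J u"
    and "dg_scheme N k \<xi> \<omega> xh fstar fhat Wx J u"
    and "entropy_stable_flux fhat"
  shows "(\<forall>i\<in>{1..N}. \<forall>t\<in>J.
            (element_entropy k \<omega> xh u i has_real_derivative
               (potential (u i k t) - entropy_var (u i k t) \<bullet> interface_flux k fhat u i t)
               - (potential (u i 0 t) - entropy_var (u i 0 t) \<bullet> interface_flux k fhat u (i - 1) t))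
            (at t within J))
       \<and> (\<forall>i\<in>{0..N}. \<forall>t\<in>J. interface_production k fhat u i t \<le> 0)
       \<and> (periodic_bc N k J u \<or> compact_bc N k J u \<longrightarrow>
            antimono_on J (total_entropy N k \<omega> xh u))"
proof (intro conjI)
  let ?b = "\<lambda>i t. (potential (u i k t) - entropy_var (u i k t) \<bullet> interface_flux k fhat u i t)
    - (potential (u i 0 t) - entropy_var (u i 0 t) \<bullet> interface_flux k fhat u (i - 1) t)"
  have balance: "(element_entropy k \<omega> xh u i has_real_derivative ?b i t) (at t within J)"
    if "i \<in> {1..N}" "t \<in> J" for i t
    by (rule element_entropy_balance[OF assms(2) assms(3)[OF that(1)] assms(6-8) that])
  then show "\<forall>i\<in>{1..N}. \<forall>t\<in>J. (element_entropy k \<omega> xh u i has_real_derivative ?b i t) (at t within J)"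
    by blast
  have production: "interface_production k fhat u i t \<le> 0" if "i \<in> {0..N}" "t \<in> J" for i t
  proof (rule interface_production_nonpos[OF assms(9)])
    show "u i k t \<in> admissible"
      using assms(7) that by (cases "i = 0") (auto simp: solution_admissible_def)
    show "u (i + 1) 0 t \<in> admissible"
      using assms(7) that by (cases "i = N") (auto simp: solution_admissible_def)
  qed
  then show "\<forall>i\<in>{0..N}. \<forall>t\<in>J. interface_production k fhat u i t \<le> 0"
    by blast
  show "periodic_bc N k J u \<or> compact_bc N k J u \<longrightarrow> antimono_on J (total_entropy N k \<omega> xh u)"
  proof
    assume bc: "periodic_bc N k J u \<or> compact_bc N k J u"
    show "antimono_on J (total_entropy N k \<omega> xh u)"
    proof (rule nonpos_derivative_antimono_on[OF assms(4)])
      show "(total_entropy N k \<omega> xh u has_real_derivative (\<Sum>i=1..N. ?b i t)) (at t within J)"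
        if "t \<in> J" for t
        unfolding total_entropy_def[abs_def] using that by (intro DERIV_sum balance) auto
      show "(\<Sum>i=1..N. ?b i t) \<le> 0" if t: "t \<in> J" for t
      proof -
        let ?D = "(potential (u N k t) - entropy_var (u N k t) \<bullet> interface_flux k fhat u N t)
          - (potential (u 1 0 t) - entropy_var (u 1 0 t) \<bullet> interface_flux k fhat u 0 t)"
        have "?D \<le> 0"
          using bc
        proof
          assume "periodic_bc N k J u"
          then have "?D = interface_production k fhat u N t"
            using t by (simp add: periodic_bc_def interface_production_def interface_flux_def
                inner_diff_left)
          then show ?thesis
            using production[of N t] t by simp
        next
          assume "compact_bc N k J u"
          then obtain uL uR where "uL \<in> admissible" "uR \<in> admissible"
            "entropy_flux uL = entropy_flux uR"
            "u 0 k t = uL" "u 1 0 t = uL" "u N k t = uR" "u (N + 1) 0 t = uR"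
            using t unfolding compact_bc_def by blast
          moreover have "consistent_flux fhat"
            using assms(9) by (simp add: entropy_stable_flux_def)
          ultimately show ?thesis
            by (simp add: interface_flux_def consistent_boundary_flux)
        qed
        moreover have "(\<Sum>i=1..<N. interface_production k fhat u i t) \<le> 0"
          by (rule sum_nonpos) (use production t in auto)
        ultimately show ?thesis
          using sum_element_balance[OF assms(1), of u k t fhat] by simp
      qed
    qed
  qed
qed

end
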